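(* Let $\hat g\colon M_n\to\mathbb{R}$ be a real-valued function on $M_n=\{(x_1,\dots,x_n)\in(0,\infty)^n : x_1\geq\dots\geq x_n\}$, and let $W\colon\mathrm{GL}^+(n)\to\mathbb{R}$ be given by $W(F)=\hat g(\hat\lambda_1(F),\dots,\hat\lambda_n(F))$, where $\hat\lambda_1(F)\geq\dots\geq\hat\lambda_n(F)$ are the ordered singular values of $F$. If $\hat g\in C^2(M_n)$ and $W$ is Legendre-Hadamard elliptic at each $F\in\mathrm{GL}^+(n)$ with simple singular values $\hat\lambda_1(F)>\dots>\hat\lambda_n(F)$, then $W$ is rank-one convex on $\mathrm{GL}^+(n)$.
   Context: $\mathrm{GL}^+(n)$ is the group of real invertible $n\times n$ matrices with positive determinant. $\hat g\in C^2(M_n)$ means $\hat g$ is twice continuously differentiable on $M_n$ up to its boundary relative to $(0,\infty)^n$ (the ordered vectors whose entries are not all distinct), i.e. it is the restriction of a $C^2$ function on an open neighbourhood of $M_n$ in $(0,\infty)^n$. A function $W\colon\mathrm{GL}^+(n)\to\mathbb{R}$ is rank-one convex if for all $F_1,F_2\in\mathrm{GL}^+(n)$ with $\operatorname{rank}(F_2-F_1)=1$ and all $t\in[0,1]$, $W((1-t)F_1+tF_2)\leq(1-t)W(F_1)+tW(F_2)$. $W$ is Legendre-Hadamard elliptic at $F$ if $W$ is twice differentiable at $F$ and $D^2W[F].(\xi\otimes\eta,\xi\otimes\eta)\geq0$ for all $\xi,\eta\in\mathbb{R}^n$. *)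

theory Defs
  imports "HOL-Analysis.Analysis"
begin

text \<open>Dimension n = CARD('n); the index type carries a linear order giving
  the index ordering 1 < ... < n (every n is realised by num1/bit0/bit1).\<close>

definition GLp :: "(real^'n^'n) set" where
  "GLp = {F. det F > 0}"

definition diag_mat :: "real^'n \<Rightarrow> real^'n^'n" where
  "diag_mat x = (\<chi> i j. if i = j then x $ i else 0)"

definition outer :: "real^'n \<Rightarrow> real^'n \<Rightarrow> real^'n^'n" where
  "outer xi eta = (\<chi> i j. xi $ i * eta $ j)"

definition pos_orthant :: "(real^'n::{finite,linorder}) set" where
  "pos_orthant = {x. \<forall>i. x $ i > 0}"

definition Mn :: "(real^'n::{finite,linorder}) set" where
  "Mn = {x. (\<forall>i. x $ i > 0) \<and> (\<forall>i j. i \<le> j \<longrightarrow> x $ j \<le> x $ i)}"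

text \<open>Ordered singular values: the (unique) decreasingly ordered nonnegative
  diagonal of a singular value decomposition F = U diag(s) V.\<close>
definition sing_vals :: "((real, 'n::{finite,linorder}) vec, 'n) vec \<Rightarrow> (real, 'n) vec" where
  "sing_vals F = (SOME s. (\<forall>i. s $ i \<ge> 0) \<and> (\<forall>i j. i \<le> j \<longrightarrow> s $ j \<le> s $ i) \<and>
      (\<exists>U V. orthogonal_matrix U \<and> orthogonal_matrix V \<and> F = U ** diag_mat s ** V))"

definition C2_on :: "('a::real_normed_vector \<Rightarrow> real) \<Rightarrow> 'a set \<Rightarrow> bool" where
  "C2_on f U \<longleftrightarrow> (\<exists>f' f''. (\<forall>x\<in>U. (f has_derivative blinfun_apply (f' x)) (at x)
        \<and> (f' has_derivative blinfun_apply (f'' x)) (at x)) \<and> continuous_on U f'')"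

definition C2_Mn :: "(real^'n::{finite,linorder} \<Rightarrow> real) \<Rightarrow> bool" where
  "C2_Mn g \<longleftrightarrow> (\<exists>U G. open U \<and> Mn \<subseteq> U \<and> U \<subseteq> pos_orthant \<and> C2_on G U
        \<and> (\<forall>x\<in>Mn. G x = g x))"

definition LH_elliptic_at :: "(real^'n^'n \<Rightarrow> real) \<Rightarrow> real^'n^'n \<Rightarrow> bool" where
  "LH_elliptic_at W F \<longleftrightarrow> (\<exists>W' W''. (\<exists>e>0. \<forall>G\<in>ball F e.
        (W has_derivative blinfun_apply (W' G)) (at G))
      \<and> (W' has_derivative W'') (at F)
      \<and> (\<forall>xi eta. blinfun_apply (W'' (outer xi eta)) (outer xi eta) \<ge> 0))"

definition rank_one_convex_GLp :: "(real^'n^'n \<Rightarrow> real) \<Rightarrow> bool" where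
  "rank_one_convex_GLp W \<longleftrightarrow> (\<forall>F1\<in>GLp. \<forall>F2\<in>GLp. rank (F2 - F1) = 1 \<longrightarrow>
      (\<forall>t::real. 0 \<le> t \<and> t \<le> 1 \<longrightarrow>
        W ((1 - t) *\<^sub>R F1 + t *\<^sub>R F2) \<le> (1 - t) * W F1 + t * W F2))"

end

theory Submission
  imports Defs
begin

text \<open>Multiple singular values occur only in codimension two, so a generic rank-one line avoids them.
  Along such a line \<open>W\<close> has nonnegative second derivative and is convex, and convexity along an
  arbitrary rank-one segment follows by approximation, because \<open>W\<close> is continuous.

  The genericity is made explicit. If \<open>xi\<close> is a unit vector orthogonal to the range of \<open>R\<close>, then
  \<open>F = R + outer xi w\<close> satisfies \<open>transpose F ** F = transpose R ** R + outer w w\<close>. When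
  \<open>transpose R ** R\<close> has simple eigenvalues \<open>\<beta> i\<close> with eigenvectors \<open>v i\<close>, this rank-one update has a
  multiple eigenvalue only if, for some \<open>i\<close>, both \<open>w \<bullet> v i = 0\<close> and the secular equation
  \<open>1 + (\<Sum>j\<noteq>i. (w \<bullet> v j)\<^sup>2 / (\<beta> j - \<beta> i)) = 0\<close> hold. On a line \<open>w = b + t *\<^sub>R eta\<close> the first condition
  selects finitely many points, and a small change of \<open>b\<close> violates the second one there.\<close>

section \<open>Self-adjoint maps and rank-one updates\<close>

text \<open>A maximiser of the Rayleigh quotient on the unit sphere of \<open>S\<close> is an
  eigenvector. Arbitrary invariant \<open>S\<close> is allowed so that the result applies to the
  complement of eigenvectors already found.\<close>

lemma self_adjoint_eigenvector_exists:
  fixes f :: "'a::euclidean_space \<Rightarrow> 'a"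
  assumes f: "linear f" and sa: "\<And>x y. f x \<bullet> y = x \<bullet> f y"
    and S: "subspace S" "\<And>x. x \<in> S \<Longrightarrow> f x \<in> S" and z: "z \<in> S" "z \<noteq> 0"
  obtains v m where "v \<in> S" "norm v = 1" "f v = m *\<^sub>R v"
proof -
  let ?K = "S \<inter> sphere 0 1"
  have "compact ?K"
    using closed_subspace[OF S(1)] by (simp add: closed_Int_compact)
  moreover have "z /\<^sub>R norm z \<in> ?K"
    using z S(1) by (simp add: subspace_scale)
  moreover have "continuous_on ?K (\<lambda>x. f x \<bullet> x)"
    by (intro continuous_intros linear_continuous_on f[THEN linear_conv_bounded_linear[THEN iffD1]])
  ultimately obtain v where v: "v \<in> ?K" and max: "\<And>x. x \<in> ?K \<Longrightarrow> f x \<bullet> x \<le> f v \<bullet> v"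
    using continuous_attains_sup[of ?K "\<lambda>x. f x \<bullet> x"] by blast
  define m where "m = f v \<bullet> v"
  have q: "f x \<bullet> x \<le> m * (x \<bullet> x)" if "x \<in> S" for x
  proof (cases "x = 0")
    case False
    let ?y = "x /\<^sub>R norm x"
    have "?y \<in> ?K" using that False S(1) by (simp add: subspace_scale)
    from max[OF this] have "f x \<bullet> x / (norm x * norm x) \<le> m"
      by (simp add: m_def linear_scale[OF f] divide_inverse mult_ac)
    then show ?thesis
      using False by (simp add: divide_le_eq dot_square_norm power2_eq_square)
  qed (simp add: linear_0[OF f])
  define u where "u = f v - m *\<^sub>R v"
  have vS: "v \<in> S" and vv: "v \<bullet> v = 1" using v by (auto simp: dot_square_norm)
  have uS: "u \<in> S"
    unfolding u_def using S vS by (intro subspace_diff subspace_scale) auto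
  define c where "c = m * (u \<bullet> u) - f u \<bullet> u"
  \<comment> \<open>Insert \<open>v + t *\<^sub>R u\<close> into \<open>q\<close>: the constant
    terms cancel, and a term linear in \<open>t\<close> is bounded by a quadratic one. Small
    positive \<open>t\<close> then forces the residual \<open>u\<close> to vanish.\<close>
  have u2: "2 * t * (u \<bullet> u) \<le> t\<^sup>2 * c" for t
  proof -
    have "v + t *\<^sub>R u \<in> S" using S(1) vS uS by (intro subspace_add subspace_scale)
    from q[OF this] have "m + 2 * t * (f v \<bullet> u) + t\<^sup>2 * (f u \<bullet> u) \<le> m * (1 + 2 * t * (v \<bullet> u) + t\<^sup>2 * (u \<bullet> u))"
      using sa[of u v] m_def[symmetric]
      by (simp add: linear_add[OF f] linear_scale[OF f] inner_simps vv
          algebra_simps power2_eq_square inner_commute)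
    moreover have "f v = u + m *\<^sub>R v" by (simp add: u_def)
    then have "f v \<bullet> u = u \<bullet> u + m * (v \<bullet> u)" by (simp add: inner_add_left)
    ultimately show ?thesis by (simp add: c_def algebra_simps)
  qed
  have "u \<bullet> u \<le> 0"
  proof (rule ccontr)
    assume "\<not> u \<bullet> u \<le> 0"
    then have pos: "u \<bullet> u > 0" by linarith
    define t where "t = (u \<bullet> u) / (\<bar>c\<bar> + 1)"
    have "t > 0" using pos by (simp add: t_def)
    have "2 * (u \<bullet> u) \<le> t * c"
      using u2[of t] \<open>t > 0\<close> by (simp add: power2_eq_square mult.assoc mult_left_le_imp_le)
    also have "\<dots> \<le> t * (\<bar>c\<bar> + 1)" using \<open>t > 0\<close> by (intro mult_left_mono) auto
    also have "\<dots> = u \<bullet> u" by (simp add: t_def)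
    finally show False using pos by simp
  qed
  then have "u = 0" by (metis inner_ge_zero inner_eq_zero_iff order_antisym)
  then have "f v = m *\<^sub>R v" by (simp add: u_def)
  then show ?thesis using that v by auto
qed

text \<open>The index type is the coordinate type of the space, so the count alone makes such a
  family a basis.\<close>

definition orthonormal_family :: "('n::finite \<Rightarrow> real^'n) \<Rightarrow> bool" where
  "orthonormal_family v \<longleftrightarrow> (\<forall>i j. v i \<bullet> v j = (if i = j then 1 else 0))"

text \<open>The family is independent of full cardinality, so it spans; the residual of the
  expansion is orthogonal to the span and hence to itself.\<close>

lemma orthonormal_family_expansion:
  assumes v: "orthonormal_family v"
  shows "x = (\<Sum>i\<in>UNIV. (x \<bullet> v i) *\<^sub>R v i)"
proof -
  have vv: "v i \<bullet> v j = (if i = j then 1 else 0)" for i j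
    using v by (simp add: orthonormal_family_def)
  have "inj v"
    by (rule injI) (metis vv zero_neq_one)
  have orth: "pairwise orthogonal (range v)"
    by (auto simp: pairwise_def orthogonal_def vv)
  moreover have "0 \<notin> range v"
    using vv by (metis imageE inner_zero_left zero_neq_one)
  ultimately have "independent (range v)"
    by (rule pairwise_orthogonal_independent)
  then have "span (range v) = UNIV"
    using card_image[OF \<open>inj v\<close>] card_eq_dim[of "range v" UNIV] by auto
  moreover define y where "y = x - (\<Sum>i\<in>UNIV. (x \<bullet> v i) *\<^sub>R v i)"
  have "orthogonal y (v j)" for j
    by (simp add: y_def orthogonal_def inner_diff_left inner_sum_left vv if_distrib cong: if_cong)
  then have "\<And>z. z \<in> range v \<Longrightarrow> orthogonal y z" by auto
  ultimately have "orthogonal y y"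
    by (metis UNIV_I orthogonal_to_span)
  then show ?thesis by (simp add: y_def orthogonal_def)
qed

lemma orthonormal_family_inner:
  assumes v: "orthonormal_family v"
  shows "x \<bullet> y = (\<Sum>i\<in>UNIV. (x \<bullet> v i) * (y \<bullet> v i))"
proof -
  have "x \<bullet> y = (\<Sum>i\<in>UNIV. (x \<bullet> v i) *\<^sub>R v i) \<bullet> y"
    using orthonormal_family_expansion[OF v, of x] by simp
  then show ?thesis by (simp add: inner_sum_right inner_commute[of _ y])
qed

lemma orthonormal_family_eq_0:
  assumes v: "orthonormal_family v" and "\<And>i. x \<bullet> v i = 0"
  shows "x = 0"
  using orthonormal_family_expansion[OF v, of x] assms(2) by simp

text \<open>Take an orthonormal set of eigenvectors of maximal size. Were it smaller than the
  dimension, its orthogonal complement would be a nonzero invariant subspace and would supply one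
  more eigenvector.\<close>

theorem spectral_theorem_self_adjoint:
  fixes f :: "real^'n \<Rightarrow> real^'n"
  assumes f: "linear f" and sa: "\<And>x y. f x \<bullet> y = x \<bullet> f y"
  obtains v :: "'n \<Rightarrow> real^'n" and \<beta>
  where "orthonormal_family v" "\<And>i. f (v i) = \<beta> i *\<^sub>R v i"
proof -
  define P where "P B \<longleftrightarrow> pairwise orthogonal B \<and> (\<forall>b\<in>B. norm b = 1 \<and> (\<exists>m. f b = m *\<^sub>R b))"
    for B :: "(real^'n) set"
  have ind: "independent B" if "P B" for B
    using that by (intro pairwise_orthogonal_independent) (auto simp: P_def)
  have "P {}" by (simp add: P_def)
  moreover have "\<forall>B. P B \<longrightarrow> card B < Suc CARD('n)"
    using ind independent_bound by (fastforce simp: less_Suc_eq_le)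
  ultimately obtain B where B: "P B" and max: "\<And>B'. P B' \<Longrightarrow> card B' \<le> card B"
    using ex_has_greatest_nat[of P "{}" card "Suc CARD('n)"] by auto
  have finB: "finite B" using ind[OF B] independent_bound by blast
  have "\<not> card B < CARD('n)"
  proof
    assume "card B < CARD('n)"
    then have "dim B < DIM(real^'n)" using dim_le_card'[OF finB] by simp
    then obtain z where z: "z \<noteq> 0" "\<And>y. y \<in> span B \<Longrightarrow> orthogonal z y"
      using orthogonal_to_subspace_exists by blast
    define S where "S = {x. \<forall>b\<in>B. x \<bullet> b = 0}"
    have "subspace S" by (auto simp: S_def subspace_def inner_simps)
    moreover have "f x \<in> S" if "x \<in> S" for x
      using that B by (fastforce simp: S_def sa P_def)
    moreover have "z \<in> S" using z(2) span_base by (auto simp: S_def orthogonal_def)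
    ultimately obtain v m where v: "v \<in> S" "norm v = 1" "f v = m *\<^sub>R v"
      using self_adjoint_eigenvector_exists[OF f sa] z(1) by metis
    have "v \<notin> B" using v by (auto simp: S_def)
    moreover have "P (insert v B)"
      using B v by (auto simp: P_def pairwise_insert S_def orthogonal_def inner_commute)
    ultimately show False using max[of "insert v B"] finB by simp
  qed
  then have "card B = CARD('n)"
    using ind[OF B] independent_bound[of B] by simp
  then obtain v :: "'n \<Rightarrow> real^'n" where v: "bij_betw v UNIV B"
    using finB by (metis finite_same_card_bij finite_class.finite_UNIV)
  have vB: "v i \<in> B" for i using v by (auto simp: bij_betw_def)
  have "orthonormal_family v"
    unfolding orthonormal_family_def
  proof (intro allI)
    fix i j
    show "v i \<bullet> v j = (if i = j then 1 else 0)"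
    proof (cases "i = j")
      case True
      then show ?thesis using B vB[of i] by (simp add: P_def dot_square_norm)
    next
      case False
      then have "v i \<noteq> v j" using v by (auto simp: bij_betw_def inj_on_def)
      then show ?thesis using False B vB by (auto simp: P_def pairwise_def orthogonal_def)
    qed
  qed
  moreover have "\<forall>i. \<exists>m. f (v i) = m *\<^sub>R v i" using B vB by (auto simp: P_def)
  ultimately show ?thesis using that by metis
qed

text \<open>An eigenspace of dimension at least two meets every hyperplane nontrivially;
  orthogonality of \<open>x\<close> and \<open>y\<close> provides the independence.\<close>

lemma orthogonal_eigenvectors_meet_hyperplane:
  fixes f :: "'a::real_inner \<Rightarrow> 'a"
  assumes f: "linear f" and x: "f x = l *\<^sub>R x" "x \<noteq> 0" and y: "f y = l *\<^sub>R y" "y \<noteq> 0"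
    and xy: "x \<bullet> y = 0"
  obtains u where "u \<noteq> 0" "u \<bullet> p = 0" "f u = l *\<^sub>R u"
proof (cases "x \<bullet> p = 0")
  case True
  then show ?thesis using that x by blast
next
  case False
  define u where "u = (y \<bullet> p) *\<^sub>R x - (x \<bullet> p) *\<^sub>R y"
  have "u \<bullet> y \<noteq> 0" using False xy y by (simp add: u_def inner_simps)
  then have "u \<noteq> 0" by auto
  moreover have "u \<bullet> p = 0" by (simp add: u_def inner_simps)
  moreover have "f u = l *\<^sub>R u"
    by (simp add: u_def linear_diff[OF f] linear_scale[OF f] x y scaleR_diff_right mult.commute)
  ultimately show ?thesis using that by blast
qed

text \<open>A multiple eigenvalue of \<open>T + outer w w\<close> has an eigenvector orthogonal to \<open>w\<close>, so it is some
  \<open>\<beta> i\<close> with \<open>w\<close> orthogonal to \<open>v i\<close>; a second eigenvector, orthogonal to \<open>v i\<close>, then forces the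
  secular equation at \<open>\<beta> i\<close>.\<close>
lemma rank_one_update_simple_spectrum:
  fixes T :: "real^'n \<Rightarrow> real^'n" and w :: "real^'n"
  assumes v: "orthonormal_family v" and T: "linear T" "\<And>x i. T x \<bullet> v i = \<beta> i * (x \<bullet> v i)"
    and \<beta>: "inj \<beta>"
    and sec: "\<And>i. w \<bullet> v i = 0 \<Longrightarrow> 1 + (\<Sum>j\<in>-{i}. (w \<bullet> v j)\<^sup>2 / (\<beta> j - \<beta> i)) \<noteq> 0"
    and x: "T x + (w \<bullet> x) *\<^sub>R w = l *\<^sub>R x" "x \<noteq> 0"
    and y: "T y + (w \<bullet> y) *\<^sub>R w = l *\<^sub>R y" "y \<noteq> 0"
  shows "x \<bullet> y \<noteq> 0"
proof
  assume xy: "x \<bullet> y = 0"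
  let ?f = "\<lambda>x. T x + (w \<bullet> x) *\<^sub>R w"
  have f: "linear ?f"
    by (intro linear_compose_add T linearI) (auto simp: inner_simps algebra_simps)
  have comp: "\<beta> i * (u \<bullet> v i) + (w \<bullet> u) * (w \<bullet> v i) = l * (u \<bullet> v i)" if "?f u = l *\<^sub>R u" for u i
    using arg_cong[OF that, of "\<lambda>z. z \<bullet> v i"] by (simp add: inner_simps T)
  \<comment> \<open>Being orthogonal to \<open>w\<close>, \<open>z\<close> is an eigenvector of
    \<open>T\<close> itself, and injectivity of \<open>\<beta>\<close> makes it a multiple of a
    single \<open>v i\<close>.\<close>
  obtain z where z: "z \<noteq> 0" "z \<bullet> w = 0" "?f z = l *\<^sub>R z"
    using orthogonal_eigenvectors_meet_hyperplane[OF f x y xy] .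
  have bz: "\<beta> i = l \<or> z \<bullet> v i = 0" for i
    using comp[OF z(3), of i] z(2) by (auto simp: inner_commute)
  obtain i where i: "z \<bullet> v i \<noteq> 0"
    using orthonormal_family_eq_0[OF v] z(1) by blast
  have l: "l = \<beta> i" using bz i by metis
  have ne: "\<beta> j \<noteq> \<beta> i" if "j \<noteq> i" for j
    using \<beta> that by (auto dest: injD)
  have zj: "z \<bullet> v j = 0" if "j \<noteq> i" for j
    using bz[of j] ne[OF that] l by auto
  have "w \<bullet> z = (w \<bullet> v i) * (z \<bullet> v i)"
    unfolding orthonormal_family_inner[OF v, of w z]
    by (subst sum.remove[of _ i]) (auto simp: zj)
  then have wi: "w \<bullet> v i = 0" using z(2) i by (simp add: inner_commute)
  obtain u where u: "u \<noteq> 0" "u \<bullet> v i = 0" "?f u = l *\<^sub>R u"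
    using orthogonal_eigenvectors_meet_hyperplane[OF f x y xy] .
  \<comment> \<open>These coordinates, put back into \<open>w \<bullet> u\<close>, yield
    \<open>w \<bullet> u\<close> times the secular expression. So \<open>w \<bullet> u = 0\<close>,
    and then every coordinate of \<open>u\<close> vanishes.\<close>
  have uj: "u \<bullet> v j = - ((w \<bullet> u) * (w \<bullet> v j) / (\<beta> j - \<beta> i))" if "j \<noteq> i" for j
    using comp[OF u(3), of j] ne[OF that] l by (simp add: field_simps)
  have "w \<bullet> u = (\<Sum>j\<in>-{i}. (w \<bullet> v j) * (u \<bullet> v j))"
    unfolding orthonormal_family_inner[OF v, of w u]
    by (subst sum.remove[of _ i]) (auto simp: u(2) Compl_eq_Diff_UNIV)
  also have "\<dots> = - (w \<bullet> u) * (\<Sum>j\<in>-{i}. (w \<bullet> v j)\<^sup>2 / (\<beta> j - \<beta> i))"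
    unfolding sum_distrib_left by (intro sum.cong) (auto simp: uj power2_eq_square)
  finally have "(w \<bullet> u) * (1 + (\<Sum>j\<in>-{i}. (w \<bullet> v j)\<^sup>2 / (\<beta> j - \<beta> i))) = 0"
    by (simp add: algebra_simps)
  then have "w \<bullet> u = 0" using sec[OF wi] by simp
  then have "u \<bullet> v j = 0" for j using uj[of j] u(2) by (cases "j = i") auto
  then show False using orthonormal_family_eq_0[OF v] u(1) by blast
qed

section \<open>Singular values\<close>

lemma outer_mult_vec: "outer a b *v x = (b \<bullet> x) *\<^sub>R a"
  by (simp add: vec_eq_iff outer_def matrix_vector_mult_def inner_vec_def sum_distrib_right
      sum_distrib_left mult_ac)


lemma diag_mat_mult_vec: "diag_mat s *v x = (\<chi> i. s $ i * x $ i)"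
  by (simp add: vec_eq_iff diag_mat_def matrix_vector_mult_def if_distrib[of "\<lambda>z. z * _"] cong: if_cong)

lemma inner_transpose_mult_vec:
  fixes A :: "real^'n^'m"
  shows "(transpose A *v x) \<bullet> y = x \<bullet> (A *v y)"
  by (simp add: dot_lmul_matrix)

text \<open>The matrix norm here is the Frobenius norm, so Cauchy-Schwarz is applied row by
  row.\<close>

lemma norm_matrix_vector_mult_le:
  fixes A :: "real^'n^'m"
  shows "norm (A *v x) \<le> norm A * norm x"
proof -
  have "norm (A *v x) = L2_set (\<lambda>i. norm ((A $ i) \<bullet> x)) UNIV"
    by (simp add: norm_vec_def matrix_vector_mul_component)
  also have "\<dots> \<le> L2_set (\<lambda>i. norm (A $ i) * norm x) UNIV"
    by (intro L2_set_mono) (auto simp: Cauchy_Schwarz_ineq2)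
  also have "\<dots> = norm A * norm x"
    by (simp add: norm_vec_def[of A] L2_set_left_distrib)
  finally show ?thesis .
qed

lemma norm_orthogonal_matrix_mult:
  fixes U :: "real^'n^'n"
  assumes "orthogonal_matrix U"
  shows "norm (U *v x) = norm x"
  using assms orthogonal_transformation_matrix[of "(*v) U"]
  by (simp add: orthogonal_transformation_norm)

lemma orthonormal_family_rows:
  "orthogonal_matrix V \<longleftrightarrow> orthonormal_family (\<lambda>i. row i V)"
  unfolding orthogonal_matrix_orthonormal_rows orthonormal_family_def orthogonal_def
  by (auto simp: norm_eq_1)

text \<open>Only the right factor is exposed: its rows are the right singular vectors, which
  determine \<open>norm (F *v x)\<close> and diagonalise \<open>transpose F ** F\<close>.\<close>

definition svd ::
  "((real, 'n::{finite,linorder}) vec, 'n) vec \<Rightarrow> (real, 'n) vec \<Rightarrow> ((real, 'n) vec, 'n) vec \<Rightarrow> bool" where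
  "svd F s V \<longleftrightarrow> (\<forall>i. s $ i \<ge> 0) \<and> (\<forall>i j. i \<le> j \<longrightarrow> s $ j \<le> s $ i) \<and> orthogonal_matrix V \<and>
    (\<exists>U. orthogonal_matrix U \<and> F = U ** diag_mat s ** V)"

lemma svd_norm:
  assumes "svd F s V"
  shows "(norm (F *v x))\<^sup>2 = (\<Sum>i\<in>UNIV. (s $ i)\<^sup>2 * (x \<bullet> row i V)\<^sup>2)"
proof -
  obtain U where U: "orthogonal_matrix U" "F = U ** diag_mat s ** V"
    using assms by (auto simp: svd_def)
  have "norm (F *v x) = norm (diag_mat s *v (V *v x))"
    by (simp add: U norm_orthogonal_matrix_mult matrix_vector_mul_assoc[symmetric])
  then have "(norm (F *v x))\<^sup>2 = (diag_mat s *v (V *v x)) \<bullet> (diag_mat s *v (V *v x))"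
    by (simp add: dot_square_norm)
  also have "\<dots> = (\<Sum>i\<in>UNIV. (s $ i * (row i V \<bullet> x)) * (s $ i * (row i V \<bullet> x)))"
    unfolding inner_vec_def[of "diag_mat s *v _"]
    by (simp add: diag_mat_mult_vec matrix_vector_mul_component row_def)
  finally show ?thesis
    by (simp add: power2_eq_square inner_commute mult_ac)
qed

text \<open>The left factor cancels in \<open>transpose F ** F\<close>. Thus a repeated singular
  value shows up as two orthogonal eigenvectors of the Gram matrix with one eigenvalue.\<close>

lemma svd_right_vector:
  assumes "svd F s V"
  shows "transpose F *v (F *v row i V) = (s $ i)\<^sup>2 *\<^sub>R row i V"
proof -
  obtain U where U: "orthogonal_matrix U" "F = U ** diag_mat s ** V" and V: "orthogonal_matrix V"
    using assms by (auto simp: svd_def)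
  have dt: "transpose (diag_mat s) = diag_mat s"
    by (simp add: vec_eq_iff transpose_def diag_mat_def)
  have "transpose F ** F = transpose V ** diag_mat s ** (transpose U ** U) ** diag_mat s ** V"
    by (simp add: U(2) matrix_transpose_mul dt matrix_mul_assoc)
  also have "\<dots> = transpose V ** diag_mat s ** diag_mat s ** V"
    using U(1) by (simp add: orthogonal_matrix)
  finally have "transpose F *v (F *v row i V)
      = transpose V *v (diag_mat s *v (diag_mat s *v (V *v row i V)))"
    by (simp add: matrix_vector_mul_assoc matrix_mul_assoc)
  also have "V *v row i V = axis i 1"
    using V by (simp add: orthonormal_family_rows orthonormal_family_def vec_eq_iff
        matrix_vector_mul_component axis_def row_def)
  also have "diag_mat s *v axis i 1 = s $ i *\<^sub>R axis i 1"
    by (simp add: diag_mat_mult_vec vec_eq_iff axis_def)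
  also have "diag_mat s *v (s $ i *\<^sub>R axis i 1) = (s $ i)\<^sup>2 *\<^sub>R axis i 1"
    by (simp add: diag_mat_mult_vec vec_eq_iff axis_def power2_eq_square)
  also have "transpose V *v ((s $ i)\<^sup>2 *\<^sub>R axis i 1) = (s $ i)\<^sup>2 *\<^sub>R row i V"
    by (simp add: matrix_vector_mult_scaleR matrix_vector_mult_basis column_transpose)
  finally show ?thesis .
qed

lemma svd_weyl:
  assumes F: "svd F s V" and F': "svd F' s' V'"
  shows "s $ i \<le> s' $ i + norm (F - F')"
proof -
  \<comment> \<open>Courant--Fischer: \<open>?T\<close> has at most \<open>n - 1\<close> elements, and on a vector orthogonal to it
    \<open>F\<close> stretches by at least \<open>s $ i\<close> and \<open>F'\<close> by at most \<open>s' $ i\<close>.\<close>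
  let ?T = "(\<lambda>j. row j V) ` {i<..} \<union> (\<lambda>j. row j V') ` {..<i}"
  have "card ?T \<le> card {i<..} + card {..<i}"
    by (intro order_trans[OF card_Un_le] add_mono card_image_le) auto
  also have "\<dots> = card (UNIV - {i})"
  proof -
    have "card ({i<..} \<union> {..<i}) = card {i<..} + card {..<i}"
      by (rule card_Un_disjoint) auto
    moreover have "{i<..} \<union> {..<i} = UNIV - {i}" by auto
    ultimately show ?thesis by (simp only:)
  qed
  also have "\<dots> < CARD('a)"
    by (intro psubset_card_mono) auto
  finally have "dim ?T < DIM((real, 'a) vec)"
    using dim_le_card'[of ?T] by simp
  then obtain x where x: "x \<noteq> 0" and orth: "\<And>y. y \<in> span ?T \<Longrightarrow> orthogonal x y"
    using orthogonal_to_subspace_exists by blast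
  have xV: "x \<bullet> row j V = 0" if "i < j" for j
    using orth[OF span_base] that by (auto simp: orthogonal_def)
  have xV': "x \<bullet> row j V' = 0" if "j < i" for j
    using orth[OF span_base] that by (auto simp: orthogonal_def)
  have n: "(norm x)\<^sup>2 = (\<Sum>j\<in>UNIV. (x \<bullet> row j V)\<^sup>2)" if "orthogonal_matrix V" for V
    using orthonormal_family_inner[OF that[unfolded orthonormal_family_rows], of x x]
    by (simp add: power2_norm_eq_inner power2_eq_square[of "_ \<bullet> _"])
  have "(s $ i * norm x)\<^sup>2 = (\<Sum>j\<in>UNIV. (s $ i)\<^sup>2 * (x \<bullet> row j V)\<^sup>2)"
    using F n[of V] by (simp add: power_mult_distrib sum_distrib_left svd_def)
  also have "\<dots> \<le> (\<Sum>j\<in>UNIV. (s $ j)\<^sup>2 * (x \<bullet> row j V)\<^sup>2)"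
  proof (intro sum_mono)
    fix j show "(s $ i)\<^sup>2 * (x \<bullet> row j V)\<^sup>2 \<le> (s $ j)\<^sup>2 * (x \<bullet> row j V)\<^sup>2"
    proof (cases "i < j")
      case False
      then have "0 \<le> s $ i" "s $ i \<le> s $ j" using F by (auto simp: svd_def)
      then show ?thesis by (intro mult_right_mono power_mono) auto
    qed (simp add: xV)
  qed
  also have "\<dots> = (norm (F *v x))\<^sup>2" using svd_norm[OF F] by simp
  finally have 1: "s $ i * norm x \<le> norm (F *v x)" by (rule power2_le_imp_le) simp
  have "(norm (F' *v x))\<^sup>2 = (\<Sum>j\<in>UNIV. (s' $ j)\<^sup>2 * (x \<bullet> row j V')\<^sup>2)"
    using svd_norm[OF F'] .
  also have "\<dots> \<le> (\<Sum>j\<in>UNIV. (s' $ i)\<^sup>2 * (x \<bullet> row j V')\<^sup>2)"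
  proof (intro sum_mono)
    fix j show "(s' $ j)\<^sup>2 * (x \<bullet> row j V')\<^sup>2 \<le> (s' $ i)\<^sup>2 * (x \<bullet> row j V')\<^sup>2"
    proof (cases "j < i")
      case False
      then have "0 \<le> s' $ j" "s' $ j \<le> s' $ i" using F' by (auto simp: svd_def)
      then show ?thesis by (intro mult_right_mono power_mono) auto
    qed (simp add: xV')
  qed
  also have "\<dots> = (s' $ i * norm x)\<^sup>2"
    using F' n[of V'] by (simp add: power_mult_distrib sum_distrib_left svd_def)
  finally have 2: "norm (F' *v x) \<le> s' $ i * norm x"
    by (rule power2_le_imp_le) (use F' in \<open>simp add: svd_def\<close>)
  have "norm (F *v x) \<le> norm (F' *v x) + norm ((F - F') *v x)"
    by (simp add: matrix_vector_mult_diff_rdistrib norm_triangle_sub)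
  also have "\<dots> \<le> s' $ i * norm x + norm (F - F') * norm x"
    using 2 norm_matrix_vector_mult_le by (rule add_mono)
  finally have "s $ i * norm x \<le> (s' $ i + norm (F - F')) * norm x"
    using 1 by (simp add: algebra_simps)
  then show ?thesis using x by simp
qed

lemma sorting_bij_exists:
  fixes \<beta> :: "'n::{finite,linorder} \<Rightarrow> 'b::linorder"
  obtains p :: "'n \<Rightarrow> 'n" where "bij p" "\<And>i j. i \<le> j \<Longrightarrow> \<beta> (p i) \<le> \<beta> (p j)"
proof -
  define xs where "xs = sort_key \<beta> (sorted_list_of_set (UNIV :: 'n set))"
  \<comment> \<open>\<open>r i\<close> is the position of \<open>i\<close>, counted from 0, in the
    order of the index type; it translates indices into list positions.\<close>
  define r where "r i = card {..<i}" for i :: 'n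
  have xs: "distinct xs" "length xs = CARD('n)" "sorted (map \<beta> xs)"
    by (simp_all add: xs_def)
  have r_less: "r i < r j" if "i < j" for i j
    unfolding r_def using that by (intro psubset_card_mono) auto
  have r_lt: "r i < length xs" for i
    unfolding r_def xs(2) by (intro psubset_card_mono) auto
  define p where "p i = xs ! r i" for i
  have "inj p"
  proof (rule injI)
    fix i j assume "p i = p j"
    then have "r i = r j" using r_lt xs(1) by (simp add: p_def nth_eq_iff_index_eq)
    then show "i = j" using r_less by (metis less_irrefl linorder_neqE)
  qed
  then have "bij p" by (simp add: bij_def finite_UNIV_inj_surj)
  moreover have "\<beta> (p i) \<le> \<beta> (p j)" if "i \<le> j" for i j
  proof -
    have "r i \<le> r j" using r_less that by (metis order.order_iff_strict)
    then show ?thesis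
      using sorted_nth_mono[OF xs(3), of "r i" "r j"] r_lt by (simp add: p_def)
  qed
  ultimately show ?thesis using that by blast
qed

text \<open>The rows of \<open>V\<close> are an eigenbasis of \<open>transpose F ** F\<close>, the
  singular values are the roots of its eigenvalues, and the columns of \<open>U\<close> are the
  normalised images \<open>F *v v i\<close>. Invertibility makes the eigenvalues positive, so the
  normalisation is possible.\<close>

lemma svd_exists:
  fixes F :: "((real, 'n::{finite,linorder}) vec, 'n) vec"
  assumes "invertible F"
  shows "\<exists>s V. svd F s V"
proof -
  let ?f = "\<lambda>x. transpose F *v (F *v x)"
  have "linear ?f"
    by (simp add: matrix_vector_mul_assoc)
  moreover have "?f x \<bullet> y = x \<bullet> ?f y" for x y
    by (metis inner_commute inner_transpose_mult_vec)
  ultimately obtain v0 \<beta>0 where v0: "orthonormal_family v0" "\<And>i. ?f (v0 i) = \<beta>0 i *\<^sub>R v0 i"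
    using spectral_theorem_self_adjoint by blast
  \<comment> \<open>Sorting the negated eigenvalues gives the decreasing order.\<close>
  obtain p :: "'n \<Rightarrow> 'n" where p: "bij p" "\<And>i j. i \<le> j \<Longrightarrow> - \<beta>0 (p i) \<le> - \<beta>0 (p j)"
    using sorting_bij_exists[of "\<lambda>i. - \<beta>0 i"] by blast
  define v where "v i = v0 (p i)" for i
  define \<beta> where "\<beta> i = \<beta>0 (p i)" for i
  have v: "orthonormal_family v"
    using v0(1) bij_is_inj[OF p(1)] by (simp add: orthonormal_family_def v_def inj_eq)
  then have vv: "v i \<bullet> v j = (if i = j then 1 else 0)" for i j
    by (simp add: orthonormal_family_def)
  have Fv: "(F *v v i) \<bullet> (F *v v j) = (if i = j then \<beta> i else 0)" for i j
  proof -
    have "(F *v v i) \<bullet> (F *v v j) = ?f (v i) \<bullet> v j"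
      by (rule inner_transpose_mult_vec[symmetric])
    also have "\<dots> = \<beta> i * (v i \<bullet> v j)"
      by (simp add: v_def v0 \<beta>_def del: transpose_matrix_vector)
    finally show ?thesis by (simp add: vv)
  qed
  have pos: "\<beta> i > 0" for i
  proof -
    have "v i \<noteq> 0" using vv[of i i] by auto
    then have "F *v v i \<noteq> 0"
      using assms by (metis invertible_def matrix_left_invertible_ker)
    then show ?thesis using Fv[of i i] by (metis inner_gt_zero_iff)
  qed
  define s :: "(real, 'n) vec" where "s = (\<chi> i. sqrt (\<beta> i))"
  define d :: "(real, 'n) vec" where "d = (\<chi> i. 1 / sqrt (\<beta> i))"
  define V :: "((real, 'n) vec, 'n) vec" where "V = (\<chi> i. v i)"
  define U where "U = F ** transpose V ** diag_mat d"
  have rowV: "row i V = v i" for i by (simp add: V_def row_def)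
  have V: "orthogonal_matrix V" using v by (simp add: orthonormal_family_rows rowV)
  have "column i U = d $ i *\<^sub>R (F *v v i)" for i
  proof -
    have "column i U = F *v (transpose V *v (diag_mat d *v axis i 1))"
      by (simp add: U_def matrix_vector_mult_basis[symmetric] matrix_vector_mul_assoc matrix_mul_assoc)
    also have "diag_mat d *v axis i 1 = d $ i *\<^sub>R axis i 1"
      by (simp add: diag_mat_mult_vec vec_eq_iff axis_def)
    finally show ?thesis
      by (simp add: matrix_vector_mult_scaleR matrix_vector_mult_basis column_transpose rowV)
  qed
  then have colU: "column i U \<bullet> column j U = (if i = j then 1 else 0)" for i j
    using pos[of i] by (auto simp: Fv d_def)
  have "orthogonal_matrix U"
    unfolding orthogonal_matrix_orthonormal_columns orthogonal_def by (simp add: norm_eq_1 colU)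
  moreover have "diag_mat d ** diag_mat s = mat 1"
  proof -
    have "sqrt (\<beta> i) \<noteq> 0" for i using pos[of i] by simp
    then have "(diag_mat d ** diag_mat s) *v x = x" for x
      by (simp add: matrix_vector_mul_assoc[symmetric] diag_mat_mult_vec vec_eq_iff d_def s_def)
    then show ?thesis by (metis matrix_eq matrix_vector_mul_lid)
  qed
  then have "U ** diag_mat s ** V = F"
    using V by (simp add: U_def matrix_mul_assoc[symmetric] orthogonal_matrix)
  moreover have "s $ j \<le> s $ i" if "i \<le> j" for i j
    using p(2)[OF that] by (simp add: s_def \<beta>_def)
  moreover have "s $ i \<ge> 0" for i using pos[of i] by (simp add: s_def)
  ultimately have "svd F s V" using V by (auto simp: svd_def)
  then show ?thesis by blast
qed

lemma svd_sing_vals: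
  assumes "F \<in> GLp"
  obtains V where "svd F (sing_vals F) V"
proof -
  have "invertible F" using assms by (simp add: GLp_def invertible_det_nz)
  from svd_exists[OF this]
  have "\<exists>s. (\<forall>i. s $ i \<ge> 0) \<and> (\<forall>i j. i \<le> j \<longrightarrow> s $ j \<le> s $ i) \<and>
      (\<exists>U V. orthogonal_matrix U \<and> orthogonal_matrix V \<and> F = U ** diag_mat s ** V)"
    by (auto simp: svd_def)
  from someI_ex[OF this] show ?thesis using that by (auto simp: sing_vals_def svd_def)
qed

lemma sing_vals_in_Mn:
  assumes "F \<in> GLp"
  shows "sing_vals F \<in> Mn"
proof -
  obtain V where V: "svd F (sing_vals F) V" using svd_sing_vals[OF assms] .
  have "sing_vals F $ i \<noteq> 0" for i
  proof
    assume "sing_vals F $ i = 0"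
    then have "transpose F *v (F *v row i V) = 0" using svd_right_vector[OF V] by simp
    moreover have "invertible F" using assms by (simp add: GLp_def invertible_det_nz)
    ultimately have "row i V = 0"
      by (metis invertible_def transpose_invertible matrix_left_invertible_ker)
    moreover have "norm (row i V) = 1"
      using V by (simp add: svd_def orthogonal_matrix_orthonormal_rows)
    ultimately show False by simp
  qed
  then show ?thesis using V by (auto simp: Mn_def svd_def less_le)
qed

text \<open>The bound \<open>svd_weyl\<close> holds for any two decompositions, hence also for those
  behind the choice in \<open>sing_vals\<close>; each component is 1-Lipschitz.\<close>

lemma continuous_on_sing_vals:
  "continuous_on (GLp :: ((real, 'n::{finite,linorder}) vec, 'n) vec set) sing_vals"
proof -
  have "\<bar>sing_vals F $ i - sing_vals F' $ i\<bar> \<le> dist F F'" if "F \<in> GLp" "F' \<in> GLp"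
    for F F' :: "((real, 'n) vec, 'n) vec" and i
    using svd_sing_vals[OF that(1)] svd_sing_vals[OF that(2)] svd_weyl
    by (smt (verit) dist_norm norm_minus_commute)
  then have "continuous_on GLp (\<lambda>F. sing_vals F $ i)" for i :: 'n
    unfolding continuous_on_iff dist_real_def
    by (metis dist_commute order_le_less_trans)
  then have "continuous_on GLp (\<lambda>F. \<chi> i::'n. sing_vals F $ i)"
    by (intro continuous_on_vec_lambda allI)
  then show ?thesis by simp
qed

lemma open_GLp: "open (GLp :: (real^'n^'n) set)"
proof -
  have "continuous_on UNIV (det :: real^'n^'n \<Rightarrow> real)"
    unfolding det_def by (intro continuous_intros)
  then show ?thesis
    unfolding GLp_def by (intro open_Collect_less) auto
qed

section \<open>Perturbing a rank-one line\<close>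

lemma outer_add_right: "outer a (b + c) = outer a b + outer a c"
  by (simp add: vec_eq_iff outer_def algebra_simps)

lemma outer_diff_right: "outer a (b - c) = outer a b - outer a c"
  by (simp add: vec_eq_iff outer_def algebra_simps)

lemma outer_scaleR_right: "outer a (r *\<^sub>R b) = r *\<^sub>R outer a b"
  by (simp add: vec_eq_iff outer_def)

lemma norm_outer: "norm (outer a b) = norm a * norm b"
proof -
  have "outer a b $ i = a $ i *\<^sub>R b" for i by (simp add: vec_eq_iff outer_def)
  then show ?thesis
    by (simp add: norm_vec_def[of "outer a b"] norm_vec_def[of a] L2_set_left_distrib)
qed

lemma matrix_mult_outer:
  fixes Q :: "real^'n^'n"
  shows "Q ** outer a b = outer (Q *v a) b"
  by (simp add: vec_eq_iff outer_def matrix_matrix_mult_def matrix_vector_mult_def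
      sum_distrib_left mult_ac)

lemma rank_1_imp_outer:
  fixes D :: "real^'n^'n"
  assumes "rank D = 1"
  obtains xi eta where "norm xi = 1" "D = outer xi eta"
proof -
  obtain B where B: "B \<subseteq> columns D" "independent B" "columns D \<subseteq> span B" "card B = dim (columns D)"
    using basis_exists by blast
  then obtain a where "B = {a}"
    using assms by (metis card_1_singletonE column_rank_def)
  with B have "a \<noteq> 0" using dependent_zero by blast
  have "\<forall>j. \<exists>c. column j D = c *\<^sub>R a"
  proof
    fix j
    have "column j D \<in> span {a}" using B(3) \<open>B = {a}\<close> by (auto simp: columns_def)
    then show "\<exists>c. column j D = c *\<^sub>R a" by (auto simp: span_singleton)
  qed
  then obtain c where c: "\<And>j. column j D = c j *\<^sub>R a" by metis
  have "D $ i $ j = c j * a $ i" for i j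
    using arg_cong[OF c[of j], of "\<lambda>z. z $ i"] by (simp add: column_def)
  then have "D = outer (a /\<^sub>R norm a) (\<chi> j. c j * norm a)"
    using \<open>a \<noteq> 0\<close> by (simp add: vec_eq_iff outer_def)
  moreover have "norm (a /\<^sub>R norm a) = 1" using \<open>a \<noteq> 0\<close> by simp
  ultimately show ?thesis using that by blast
qed

text \<open>Rotate \<open>xi\<close> to a coordinate axis: then \<open>t\<close> enters a single
  row, and the determinant is affine in that row.\<close>

lemma det_add_outer_affine:
  fixes A :: "real^'n^'n"
  assumes "norm xi = 1"
  shows "det (A + t *\<^sub>R outer xi eta) = (1 - t) * det A + t * det (A + outer xi eta)"
proof -
  obtain k :: 'n where True by simp
  obtain Q :: "real^'n^'n" where Q: "orthogonal_matrix Q" "Q *v axis k 1 = xi"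
    using orthogonal_matrix_exists_basis[OF assms] by blast
  define M where "M = transpose Q ** A"
  define d where "d = det (\<chi> i. if i = k then eta else M $ i)"
  have QM: "Q ** M = A"
    using Q(1) by (simp add: M_def matrix_mul_assoc orthogonal_matrix_def)
  have "det (A + t *\<^sub>R outer xi eta) = det A + t * (det Q * d)" for t
  proof -
    have "M + t *\<^sub>R outer (axis k 1) eta = (\<chi> i. if i = k then M $ i + t *s eta else M $ i)"
      by (simp add: vec_eq_iff outer_def axis_def)
    then have "det (M + t *\<^sub>R outer (axis k 1) eta)
        = det (\<chi> i. if i = k then M $ i else M $ i) + det (\<chi> i. if i = k then t *s eta else M $ i)"
      using det_row_add[of k "\<lambda>i. M $ i" "\<lambda>i. t *s eta" "\<lambda>i. M $ i"] by simp
    also have "\<dots> = det M + t * d"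
      using det_row_mul[of k t "\<lambda>i. eta" "\<lambda>i. M $ i"] by (simp add: d_def)
    finally have "det (Q ** (M + t *\<^sub>R outer (axis k 1) eta)) = det (Q ** M) + t * (det Q * d)"
      by (simp add: det_mul algebra_simps)
    moreover have "Q ** (M + t *\<^sub>R outer (axis k 1) eta) = A + t *\<^sub>R outer xi eta"
      by (simp add: matrix_add_ldistrib QM outer_scaleR_right[symmetric] matrix_mult_outer Q(2))
    ultimately show ?thesis by (simp add: QM)
  qed
  from this[of t] this[of 1] show ?thesis by (simp add: algebra_simps)
qed

text \<open>\<open>GLp\<close> is not convex in general, but an affine determinant that is positive
  at both ends of a rank-one segment stays positive between them.\<close>

lemma GLp_rank_one_segment:
  assumes "A \<in> GLp" "A + outer xi eta \<in> GLp" "norm xi = 1" "0 \<le> t" "t \<le> 1"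
  shows "A + t *\<^sub>R outer xi eta \<in> GLp"
proof -
  have "(1 - t) * det A + t * det (A + outer xi eta) > 0"
    using assms by (cases "t = 0") (auto simp: GLp_def intro: add_nonneg_pos)
  then show ?thesis using det_add_outer_affine[OF assms(3)] by (simp add: GLp_def)
qed

text \<open>Equal singular values would give two orthogonal rows of \<open>V\<close> that are
  eigenvectors of the Gram matrix for the same eigenvalue, which
  \<open>rank_one_update_simple_spectrum\<close> excludes.\<close>

lemma simple_sing_valsI:
  assumes F: "R + outer xi w \<in> GLp" and xi: "norm xi = 1" and R: "transpose R *v xi = 0"
    and v: "orthonormal_family v" and ev: "\<And>i. transpose R *v (R *v v i) = \<beta> i *\<^sub>R v i"
    and \<beta>: "inj \<beta>"
    and sec: "\<And>i. w \<bullet> v i = 0 \<Longrightarrow> 1 + (\<Sum>j\<in>-{i}. (w \<bullet> v j)\<^sup>2 / (\<beta> j - \<beta> i)) \<noteq> 0"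
    and ij: "i < j"
  shows "sing_vals (R + outer xi w) $ j < sing_vals (R + outer xi w) $ i"
proof (rule ccontr)
  let ?F = "R + outer xi w" and ?T = "\<lambda>x. transpose R *v (R *v x)"
  assume "\<not> ?thesis"
  moreover obtain V where V: "svd ?F (sing_vals ?F) V" using svd_sing_vals[OF F] .
  ultimately have eq: "sing_vals ?F $ j = sing_vals ?F $ i"
    using ij by (auto simp: svd_def not_less intro: antisym)
  \<comment> \<open>The cross terms vanish because \<open>xi\<close> is orthogonal to the range of
    \<open>R\<close>.\<close>
  have FF: "transpose ?F *v (?F *v x) = ?T x + (w \<bullet> x) *\<^sub>R w" for x
  proof -
    have "xi \<bullet> (R *v x) = 0"
      using inner_transpose_mult_vec[of R xi x] R by simp
    moreover have "xi \<bullet> xi = 1" using xi by (simp add: norm_eq_1)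
    moreover have "transpose ?F = transpose R + outer w xi"
      by (simp add: outer_def vec_eq_iff transpose_def mult.commute)
    ultimately show ?thesis using R
      by (simp add: matrix_vector_mult_add_rdistrib outer_mult_vec inner_add_right
          matrix_vector_right_distrib matrix_vector_mult_scaleR del: transpose_matrix_vector)
  qed
  have "linear ?T" by (simp add: matrix_vector_mul_assoc del: transpose_matrix_vector)
  moreover have "?T x \<bullet> v k = \<beta> k * (x \<bullet> v k)" for x k
  proof -
    have "?T x \<bullet> v k = x \<bullet> ?T (v k)" by (metis inner_commute inner_transpose_mult_vec)
    then show ?thesis by (simp add: ev del: transpose_matrix_vector)
  qed
  moreover have "?T (row k V) + (w \<bullet> row k V) *\<^sub>R w = (sing_vals ?F $ i)\<^sup>2 *\<^sub>R row k V"
    if "k = i \<or> k = j" for k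
    using svd_right_vector[OF V, of k] that eq unfolding FF by auto
  moreover have rows: "orthonormal_family (\<lambda>k. row k V)"
    using V by (simp add: svd_def orthonormal_family_rows)
  then have "row k V \<noteq> 0" for k
    by (metis inner_zero_left orthonormal_family_def zero_neq_one)
  ultimately have "row i V \<bullet> row j V \<noteq> 0"
    using rank_one_update_simple_spectrum[OF v, of ?T \<beta> w "row i V" "(sing_vals ?F $ i)\<^sup>2" "row j V"]
      \<beta> sec
    by blast
  then show False using rows less_imp_neq[OF ij] by (simp add: orthonormal_family_def)
qed

lemma ex_small_avoiding_finite:
  fixes e :: real
  assumes "finite S" "e > 0"
  obtains x where "0 < x" "x < e" "x \<notin> S"
proof -
  have "\<not> {0<..<e} \<subseteq> S"
    using assms infinite_Ioo finite_subset by metis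
  then obtain x where "x \<in> {0<..<e}" "x \<notin> S" by blast
  then show ?thesis using that[of x] by simp
qed

text \<open>Two generic moves: a shift off all hyperplanes orthogonal to some \<open>v i\<close>,
  after which the line meets each of them at most once, and a rescaling that breaks the secular
  equation at these points.\<close>

lemma secular_generic_vector:
  fixes b eta :: "real^'n"
  assumes v: "orthonormal_family v" and "\<delta> > 0"
  obtains c where "norm (c - b) < \<delta>"
    "\<And>t i. (c + t *\<^sub>R eta) \<bullet> v i = 0 \<Longrightarrow>
       1 + (\<Sum>j\<in>-{i}. ((c + t *\<^sub>R eta) \<bullet> v j)\<^sup>2 / (\<beta> j - \<beta> i)) \<noteq> 0"
proof -
  have vv: "v i \<bullet> v j = (if i = j then 1 else 0)" for i j
    using v by (simp add: orthonormal_family_def)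
  \<comment> \<open>\<open>p\<close> has inner product 1 with every \<open>v i\<close>, so each
    hyperplane rules out only one shift \<open>r\<close>.\<close>
  define p where "p = (\<Sum>i\<in>UNIV. v i)"
  have pv: "p \<bullet> v i = 1" for i by (simp add: p_def inner_sum_left vv)
  obtain r where r: "0 < r" "r < \<delta> / 2 / (norm p + 1)" "r \<notin> range (\<lambda>i. - (b \<bullet> v i))"
    by (rule ex_small_avoiding_finite[of "range (\<lambda>i. - (b \<bullet> v i))" "\<delta> / 2 / (norm p + 1)"])
      (use \<open>\<delta> > 0\<close> in \<open>auto intro!: divide_pos_pos add_nonneg_pos\<close>)
  define b1 where "b1 = b + r *\<^sub>R p"
  have b1v: "b1 \<bullet> v i \<noteq> 0" for i
  proof
    assume "b1 \<bullet> v i = 0"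
    then have "r = - (b \<bullet> v i)" by (simp add: b1_def inner_add_left pv)
    then show False using r(3) by blast
  qed
  \<comment> \<open>The point where the line through \<open>b1\<close> crosses the hyperplane of
    \<open>v i\<close>. If \<open>eta \<bullet> v i = 0\<close> there is no crossing, and the
    default value \<open>b1\<close> does no harm.\<close>
  define u where "u i = b1 - ((b1 \<bullet> v i) / (eta \<bullet> v i)) *\<^sub>R eta" for i
  define q where "q i = (\<Sum>j\<in>-{i}. (u i \<bullet> v j)\<^sup>2 / (\<beta> j - \<beta> i))" for i
  \<comment> \<open>The excluded values contain every positive root of
    \<open>1 + (1 + s)\<^sup>2 * q i = 0\<close>. For \<open>q i \<ge> 0\<close> there is no root
    and the excluded value is negative.\<close>
  obtain s where s: "0 < s" "s < \<delta> / 2 / (norm b1 + 1)" "s \<notin> range (\<lambda>i. sqrt (- 1 / q i) - 1)"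
    by (rule ex_small_avoiding_finite[of "range (\<lambda>i. sqrt (- 1 / q i) - 1)" "\<delta> / 2 / (norm b1 + 1)"])
      (use \<open>\<delta> > 0\<close> in \<open>auto intro!: divide_pos_pos add_nonneg_pos\<close>)
  have sq: "1 + (1 + s)\<^sup>2 * q i \<noteq> 0" for i
  proof
    assume "1 + (1 + s)\<^sup>2 * q i = 0"
    then have "(1 + s)\<^sup>2 = - 1 / q i"
      by (cases "q i = 0") (auto simp: field_simps)
    then have "sqrt (- 1 / q i) = 1 + s"
      using s(1) by (metis abs_of_pos add_pos_pos real_sqrt_abs zero_less_one)
    then show False using s(3) by (auto simp: image_iff dest: spec[of _ i])
  qed
  \<comment> \<open>Scaling \<open>b1\<close> by \<open>1 + s\<close> scales the point where the line meets the hyperplane orthogonal to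
    \<open>v i\<close>, hence the secular sum there by \<open>(1 + s)\<^sup>2\<close>.\<close>
  define c where "c = (1 + s) *\<^sub>R b1"
  show ?thesis
  proof
    have "norm (c - b) = norm (r *\<^sub>R p + s *\<^sub>R b1)"
      by (simp add: c_def b1_def algebra_simps)
    also have "\<dots> \<le> r * norm p + s * norm b1"
      using norm_triangle_ineq[of "r *\<^sub>R p" "s *\<^sub>R b1"] r(1) s(1) by simp
    also have "\<dots> \<le> r * (norm p + 1) + s * (norm b1 + 1)"
      using r(1) s(1) by (intro add_mono mult_left_mono) auto
    also have "\<dots> < \<delta> / 2 + \<delta> / 2"
      by (intro add_strict_mono pos_less_divide_eq[THEN iffD1, OF _ r(2)]
          pos_less_divide_eq[THEN iffD1, OF _ s(2)])
        (auto intro: add_nonneg_pos)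
    finally show "norm (c - b) < \<delta>" by simp
  next
    fix t i
    assume z: "(c + t *\<^sub>R eta) \<bullet> v i = 0"
    then have z': "(1 + s) * (b1 \<bullet> v i) + t * (eta \<bullet> v i) = 0"
      by (simp add: c_def inner_simps)
    have "eta \<bullet> v i \<noteq> 0"
      using z' b1v[of i] s(1) by auto
    then have "t = - ((1 + s) * ((b1 \<bullet> v i) / (eta \<bullet> v i)))"
      using z' by (simp add: field_simps add_eq_0_iff)
    then have "c + t *\<^sub>R eta = (1 + s) *\<^sub>R u i"
      by (simp add: c_def u_def scaleR_diff_right)
    then have "(\<Sum>j\<in>-{i}. ((c + t *\<^sub>R eta) \<bullet> v j)\<^sup>2 / (\<beta> j - \<beta> i)) = (1 + s)\<^sup>2 * q i"
      by (simp add: q_def sum_distrib_left power_mult_distrib)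
    then show "1 + (\<Sum>j\<in>-{i}. ((c + t *\<^sub>R eta) \<bullet> v j)\<^sup>2 / (\<beta> j - \<beta> i)) \<noteq> 0"
      using sq[of i] by simp
  qed
qed

lemma finite_affine_eq_0:
  fixes a d :: real
  assumes "a \<noteq> 0 \<or> d \<noteq> 0"
  shows "finite {x. a + x * d = 0}"
proof (cases "d = 0")
  case False
  then have "{x. a + x * d = 0} \<subseteq> {- a / d}" by (auto simp: field_simps)
  then show ?thesis by (rule finite_subset) simp
qed (use assms in simp)

text \<open>Only the base point moves, so the perturbed line keeps its rank-one direction. The Gram
  spectrum of \<open>R0\<close> is made simple first; \<open>b\<close> is then perturbed relative to
  the new eigenvalues.\<close>

lemma generic_rank_one_line:
  fixes A :: "((real, 'n::{finite,linorder}) vec, 'n) vec" and eta :: "(real, 'n) vec"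
  assumes A: "A \<in> GLp" and xi: "norm xi = 1" and "\<delta> > 0"
  obtains A' where "norm (A' - A) < \<delta>"
    "\<And>t i j. A' + t *\<^sub>R outer xi eta \<in> GLp \<Longrightarrow> i < j \<Longrightarrow>
       sing_vals (A' + t *\<^sub>R outer xi eta) $ j < sing_vals (A' + t *\<^sub>R outer xi eta) $ i"
proof -
  \<comment> \<open>With \<open>R0\<close> the projection of \<open>A\<close> onto the complement of \<open>xi\<close>, the Gram matrix of
    \<open>A + t *\<^sub>R outer xi eta\<close> is \<open>transpose R0 ** R0 + outer w w\<close> for \<open>w = b + t *\<^sub>R eta\<close>; so \<open>R0\<close> and
    \<open>b\<close> can be perturbed separately.\<close>
  define b where "b = transpose A *v xi"
  define R0 where "R0 = A - outer xi b"
  let ?f = "\<lambda>x. transpose R0 *v (R0 *v x)"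
  have xx: "xi \<bullet> xi = 1" using xi by (simp add: norm_eq_1)
  have R0v: "R0 *v x = A *v x - (b \<bullet> x) *\<^sub>R xi" for x
    by (simp add: R0_def matrix_vector_mult_diff_rdistrib outer_mult_vec)
  have xiR0: "xi \<bullet> (R0 *v x) = 0" for x
    by (simp add: R0v inner_diff_right xx b_def inner_transpose_mult_vec del: transpose_matrix_vector)
  have "linear ?f" by (simp add: matrix_vector_mul_assoc del: transpose_matrix_vector)
  moreover have "?f x \<bullet> y = x \<bullet> ?f y" for x y
    by (metis inner_commute inner_transpose_mult_vec)
  ultimately obtain v \<beta> where v: "orthonormal_family v" and ev: "\<And>i. ?f (v i) = \<beta> i *\<^sub>R v i"
    using spectral_theorem_self_adjoint by blast
  have vv: "v i \<bullet> v j = (if i = j then 1 else 0)" for i j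
    using v by (simp add: orthonormal_family_def)
  define \<rho> where "\<rho> i = norm (R0 *v v i)" for i
  have RR: "(R0 *v v i) \<bullet> (R0 *v v j) = (if i = j then (\<rho> i)\<^sup>2 else 0)" for i j
  proof (cases "i = j")
    case False
    have "(R0 *v v i) \<bullet> (R0 *v v j) = ?f (v i) \<bullet> v j"
      by (rule inner_transpose_mult_vec[symmetric])
    then show ?thesis using False by (simp add: ev vv del: transpose_matrix_vector)
  qed (simp add: \<rho>_def power2_norm_eq_inner)
  have A0: "x = 0" if "A *v x = 0" for x
    using A that by (metis (mono_tags) GLp_def invertible_def invertible_det_nz less_irrefl
        matrix_left_invertible_ker mem_Collect_eq)
  \<comment> \<open>Scaling cannot separate two zero singular values. At most one occurs:
    \<open>A\<close> would map two null vectors of \<open>R0\<close> into the line of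
    \<open>xi\<close>, contradicting invertibility.\<close>
  have \<rho>0: "\<rho> i \<noteq> 0 \<or> \<rho> j \<noteq> 0" if "i \<noteq> j" for i j
  proof (rule ccontr)
    assume "\<not> ?thesis"
    then have Av: "A *v v i = (b \<bullet> v i) *\<^sub>R xi" "A *v v j = (b \<bullet> v j) *\<^sub>R xi"
      by (auto simp: \<rho>_def R0v)
    then have "A *v ((b \<bullet> v j) *\<^sub>R v i - (b \<bullet> v i) *\<^sub>R v j) = 0"
      by (simp add: matrix_vector_mult_diff_distrib matrix_vector_mult_scaleR)
    from A0[OF this] have "((b \<bullet> v j) *\<^sub>R v i - (b \<bullet> v i) *\<^sub>R v j) \<bullet> v i = 0"
      by simp
    then have "b \<bullet> v j = 0" using that by (simp add: inner_diff_left vv)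
    then have "v j = 0" using Av(2) A0 by simp
    then show False using vv[of j j] by simp
  qed
  obtain c :: "'n \<Rightarrow> nat" where c: "inj c"
    using finite_imp_inj_to_nat_seg[OF finite_class.finite_UNIV] by blast
  \<comment> \<open>Scaling the singular direction \<open>v i\<close> of \<open>R0\<close> by \<open>1 + e * c i\<close> keeps the singular vectors
    and separates the singular values.\<close>
  define K where "K = (\<Sum>i\<in>UNIV. outer (real (c i) *\<^sub>R (R0 *v v i)) (v i))"
  have Kv: "K *v v i = real (c i) *\<^sub>R (R0 *v v i)" for i
  proof -
    have "K *v x = (\<Sum>i\<in>UNIV. outer (real (c i) *\<^sub>R (R0 *v v i)) (v i) *v x)" for x
      unfolding K_def by (induction rule: infinite_finite_induct)
        (auto simp: matrix_vector_mult_add_rdistrib)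
    then show ?thesis
      by (simp add: outer_mult_vec vv if_distrib[of "\<lambda>z. z * _"] if_distrib[of "\<lambda>z. z *\<^sub>R _"]
          cong: if_cong)
  qed
  \<comment> \<open>The values of \<open>e\<close> at which two scaled singular values coincide.
    Each condition is affine and nontrivial: if \<open>\<rho> i = \<rho> j\<close>, both are nonzero
    and the slopes differ since \<open>c\<close> is injective.\<close>
  define Z where "Z = (\<Union>(i, j) \<in> {(i, j). i \<noteq> j}.
      {x. (\<rho> i - \<rho> j) + x * (c i * \<rho> i - c j * \<rho> j) = 0})"
  have "finite Z"
    unfolding Z_def
  proof (intro finite_UN_I, safe)
    fix i j :: 'n assume "i \<noteq> j"
    then have "c i \<noteq> c j" using c by (auto dest: injD)
    then show "finite {x. (\<rho> i - \<rho> j) + x * (c i * \<rho> i - c j * \<rho> j) = 0}"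
      using \<rho>0[OF \<open>i \<noteq> j\<close>] by (intro finite_affine_eq_0) auto
  qed simp
  then obtain e where e: "0 < e" "e < \<delta> / 2 / (norm K + 1)" "e \<notin> Z"
    using ex_small_avoiding_finite[of Z "\<delta> / 2 / (norm K + 1)"] \<open>\<delta> > 0\<close>
    by (metis add_nonneg_pos divide_pos_pos norm_ge_zero zero_less_numeral zero_less_one)
  define R where "R = R0 + e *\<^sub>R K"
  define \<gamma> where "\<gamma> i = ((1 + e * c i) * \<rho> i)\<^sup>2" for i
  have Rv: "R *v v i = (1 + e * c i) *\<^sub>R (R0 *v v i)" for i
    by (simp add: R_def matrix_vector_mult_add_rdistrib scaleR_matrix_vector_assoc[symmetric] Kv
        scaleR_add_left)
  have "transpose R *v xi = 0"
  proof (rule orthonormal_family_eq_0[OF v])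
    show "(transpose R *v xi) \<bullet> v i = 0" for i
      by (simp add: inner_transpose_mult_vec Rv xiR0 del: transpose_matrix_vector)
  qed
  moreover have "transpose R *v (R *v v i) = \<gamma> i *\<^sub>R v i" for i
  proof -
    have "transpose R *v (R *v v i) - \<gamma> i *\<^sub>R v i = 0"
    proof (rule orthonormal_family_eq_0[OF v])
      show "(transpose R *v (R *v v i) - \<gamma> i *\<^sub>R v i) \<bullet> v j = 0" for j
        by (simp add: inner_diff_left inner_transpose_mult_vec Rv RR vv \<gamma>_def power2_eq_square
            del: transpose_matrix_vector)
    qed
    then show ?thesis by simp
  qed
  moreover have "inj \<gamma>"
  proof (rule injI, rule ccontr)
    fix i j assume "\<gamma> i = \<gamma> j" "i \<noteq> j"
    \<comment> \<open>Nonnegativity allows the squares in \<open>\<gamma>\<close> to be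
      cancelled.\<close>
    moreover have "(1 + e * c i) * \<rho> i \<ge> 0" for i using e(1) by (simp add: \<rho>_def)
    ultimately have "(1 + e * c i) * \<rho> i = (1 + e * c j) * \<rho> j"
      unfolding \<gamma>_def by (metis power2_eq_iff_nonneg)
    then have "(\<rho> i - \<rho> j) + e * (c i * \<rho> i - c j * \<rho> j) = 0" by (simp add: algebra_simps)
    then have "e \<in> Z" using \<open>i \<noteq> j\<close> by (auto simp: Z_def)
    then show False using e(3) by simp
  qed
  moreover obtain b' where b': "norm (b' - b) < \<delta> / 2"
    "\<And>t i. (b' + t *\<^sub>R eta) \<bullet> v i = 0 \<Longrightarrow>
       1 + (\<Sum>j\<in>-{i}. ((b' + t *\<^sub>R eta) \<bullet> v j)\<^sup>2 / (\<gamma> j - \<gamma> i)) \<noteq> 0"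
    using secular_generic_vector[OF v, of "\<delta> / 2" b eta \<gamma>] \<open>\<delta> > 0\<close> by auto
  ultimately have simple:
    "sing_vals (R + outer xi (b' + t *\<^sub>R eta)) $ j < sing_vals (R + outer xi (b' + t *\<^sub>R eta)) $ i"
    if "R + outer xi (b' + t *\<^sub>R eta) \<in> GLp" "i < j" for t i j
    using simple_sing_valsI[OF that(1) xi _ v _ _ _ that(2)] by blast
  have line: "R + outer xi (b' + t *\<^sub>R eta) = (R + outer xi b') + t *\<^sub>R outer xi eta" for t
    by (simp add: outer_add_right outer_scaleR_right)
  show ?thesis
  proof
    have "norm (R + outer xi b' - A) = norm (e *\<^sub>R K + outer xi (b' - b))"
      by (simp add: R_def R0_def outer_diff_right add_diff_eq)
    also have "\<dots> \<le> e * norm K + norm (b' - b)"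
      using norm_triangle_ineq[of "e *\<^sub>R K" "outer xi (b' - b)"] e(1) xi by (simp add: norm_outer)
    also have "\<dots> \<le> e * (norm K + 1) + norm (b' - b)" using e(1) by simp
    also have "\<dots> < \<delta> / 2 + \<delta> / 2"
      by (intro add_strict_mono b'(1) pos_less_divide_eq[THEN iffD1, OF _ e(2)]) (auto intro: add_nonneg_pos)
    finally show "norm (R + outer xi b' - A) < \<delta>" by simp
  qed (use simple line in auto)
qed

section \<open>Convexity along rank-one segments\<close>

text \<open>By the chain rule, the second derivative along the line is the Hessian evaluated twice
  at \<open>outer xi eta\<close>.\<close>

lemma LH_elliptic_imp_convex_on_line:
  assumes LH: "\<And>t. t \<in> {0..1} \<Longrightarrow> LH_elliptic_at W (A + t *\<^sub>R outer xi eta)"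
  shows "convex_on {0..1} (\<lambda>t. W (A + t *\<^sub>R outer xi eta))"
proof -
  let ?D = "outer xi eta" and ?L = "\<lambda>t. A + t *\<^sub>R outer xi eta"
  let ?\<phi> = "\<lambda>t. W (?L t)"
  have L: "(?L has_derivative (\<lambda>h. h *\<^sub>R ?D)) (at t)" for t :: real
    by (auto intro!: derivative_eq_intros)
  \<comment> \<open>Ellipticity supplies a separate local gradient \<open>W'\<close> at each point;
    \<open>deriv\<close> gives one first derivative common to all of them.\<close>
  have *: "\<exists>d. (?\<phi> has_real_derivative deriv ?\<phi> t) (at t) \<and>
      (deriv ?\<phi> has_real_derivative d) (at t) \<and> d \<ge> 0" if t01: "t \<in> {0..1}" for t
  proof -
    obtain W' W'' e where e: "e > 0"
      and W': "\<And>G. G \<in> ball (?L t) e \<Longrightarrow> (W has_derivative blinfun_apply (W' G)) (at G)"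
      and W'': "(W' has_derivative W'') (at (?L t))"
      and nonneg: "blinfun_apply (W'' ?D) ?D \<ge> 0"
      using LH[OF t01] unfolding LH_elliptic_at_def by blast
    define N where "N = ?L -` ball (?L t) e"
    have "open N" unfolding N_def
      by (intro open_vimage) (auto intro!: continuous_intros)
    have "t \<in> N" using e by (simp add: N_def)
    have d1: "(?\<phi> has_real_derivative blinfun_apply (W' (?L s)) ?D) (at s)" if "s \<in> N" for s
    proof -
      have "(?\<phi> has_derivative (\<lambda>h. blinfun_apply (W' (?L s)) (h *\<^sub>R ?D))) (at s)"
        using has_derivative_compose[OF L[of s] W'[of "?L s"]] that by (simp add: N_def)
      then show ?thesis
        by (simp add: has_field_derivative_def blinfun.scaleR_right mult_commute_abs)
    qed
    have "((\<lambda>s. blinfun_apply (W' (?L s)) ?D) has_derivative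
        (\<lambda>h. blinfun_apply (W'' (h *\<^sub>R ?D)) ?D)) (at t)"
      using has_derivative_compose[OF L[of t] W'']
      by (rule bounded_linear.has_derivative[OF blinfun.bounded_linear_left])
    then have "((\<lambda>s. blinfun_apply (W' (?L s)) ?D) has_real_derivative blinfun_apply (W'' ?D) ?D) (at t)"
      by (simp add: has_field_derivative_def linear_scale[OF has_derivative_linear[OF W'']]
          blinfun.scaleR_left mult_commute_abs)
    then have "(deriv ?\<phi> has_real_derivative blinfun_apply (W'' ?D) ?D) (at t)"
      by (rule has_field_derivative_transform_within_open[OF _ \<open>open N\<close> \<open>t \<in> N\<close>])
        (simp add: DERIV_imp_deriv[OF d1])
    moreover have "(?\<phi> has_real_derivative deriv ?\<phi> t) (at t)"
      using d1[OF \<open>t \<in> N\<close>] DERIV_imp_deriv by metis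
    ultimately show ?thesis using nonneg by blast
  qed
  then obtain d where "\<And>t. t \<in> {0..1} \<Longrightarrow> (?\<phi> has_real_derivative deriv ?\<phi> t) (at t)"
    "\<And>t. t \<in> {0..1} \<Longrightarrow> (deriv ?\<phi> has_real_derivative d t) (at t)"
    "\<And>t. t \<in> {0..1} \<Longrightarrow> d t \<ge> 0"
    by metis
  then show ?thesis
    by (intro f''_ge0_imp_convex[where f' = "deriv ?\<phi>" and f'' = d]) auto
qed

text \<open>On \<open>GLp\<close>, \<open>W\<close> is the continuous extension \<open>G\<close>
  composed with \<open>sing_vals\<close>; openness of \<open>GLp\<close> turns this into continuity
  at each point.\<close>

lemma isCont_sing_val_function:
  assumes W: "\<forall>F\<in>GLp. W F = g (sing_vals F)" and g: "C2_Mn g" and F: "F \<in> GLp"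
  shows "isCont W F"
proof -
  obtain U G where UG: "Mn \<subseteq> U" "C2_on G U" "\<forall>x\<in>Mn. G x = g x"
    using g by (auto simp: C2_Mn_def)
  have "isCont G x" if "x \<in> Mn" for x
    using UG(1,2) that by (auto simp: C2_on_def dest: has_derivative_continuous)
  then have "continuous_on Mn G" by (simp add: continuous_at_imp_continuous_on)
  then have "continuous_on GLp (\<lambda>F. G (sing_vals F))"
    using continuous_on_sing_vals sing_vals_in_Mn
    by (intro continuous_on_compose2[of Mn G GLp sing_vals]) auto
  then have "continuous_on GLp W"
    by (rule continuous_on_eq) (use UG(3) W sing_vals_in_Mn in auto)
  then show ?thesis using F open_GLp continuous_on_eq_continuous_at by blast
qed

theorem theorem4p5:
  fixes g :: "(real, 'n::{finite,linorder}) vec \<Rightarrow> real"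
    and W :: "((real, 'n) vec, 'n) vec \<Rightarrow> real"
  assumes W_def: "\<forall>F\<in>GLp. W F = g (sing_vals F)"
    and g_C2: "C2_Mn g"
    and LH: "\<forall>F\<in>GLp. (\<forall>i j. i < j \<longrightarrow> sing_vals F $ j < sing_vals F $ i)
               \<longrightarrow> LH_elliptic_at W F"
  shows "rank_one_convex_GLp W"
  unfolding rank_one_convex_GLp_def
proof (intro ballI impI allI)
  fix F1 F2 :: "((real, 'n) vec, 'n) vec" and t :: real
  assume F1: "F1 \<in> GLp" and F2: "F2 \<in> GLp" and rk: "rank (F2 - F1) = 1" and t: "0 \<le> t \<and> t \<le> 1"
  obtain xi eta where xi: "norm xi = 1" and D: "F2 - F1 = outer xi eta"
    using rank_1_imp_outer[OF rk] .
  let ?D = "outer xi eta"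
  have F2_eq: "F2 = F1 + ?D" using D by (simp add: algebra_simps)
  have "\<exists>A'. norm (A' - F1) < inverse (real (Suc k)) \<and>
      (\<forall>t i j. A' + t *\<^sub>R ?D \<in> GLp \<longrightarrow> i < j \<longrightarrow>
       sing_vals (A' + t *\<^sub>R ?D) $ j < sing_vals (A' + t *\<^sub>R ?D) $ i)" for k
    using generic_rank_one_line[OF F1 xi, of "inverse (real (Suc k))" eta]
    by (metis inverse_positive_iff_positive of_nat_0_less_iff zero_less_Suc)
  then obtain X where X: "\<And>k. norm (X k - F1) < inverse (real (Suc k))"
    and simple: "\<And>k t i j. X k + t *\<^sub>R ?D \<in> GLp \<Longrightarrow> i < j \<Longrightarrow>
       sing_vals (X k + t *\<^sub>R ?D) $ j < sing_vals (X k + t *\<^sub>R ?D) $ i"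
    by metis
  have "X \<longlonglongrightarrow> F1"
    by (rule LIM_zero_cancel, rule Lim_null_comparison[OF _ LIMSEQ_inverse_real_of_nat])
      (use X in \<open>auto intro!: always_eventually less_imp_le\<close>)
  then have lim: "(\<lambda>k. X k + s *\<^sub>R ?D) \<longlonglongrightarrow> F1 + s *\<^sub>R ?D" for s
    by (intro tendsto_intros)
  have mem: "F1 + s *\<^sub>R ?D \<in> GLp" if "0 \<le> s" "s \<le> 1" for s
    using GLp_rank_one_segment[OF F1 _ xi that] F2 F2_eq by simp
  have W_lim: "(\<lambda>k. W (X k + s *\<^sub>R ?D)) \<longlonglongrightarrow> W (F1 + s *\<^sub>R ?D)" if "0 \<le> s" "s \<le> 1" for s
    using isCont_tendsto_compose[OF isCont_sing_val_function[OF W_def g_C2 mem[OF that]] lim] .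
  \<comment> \<open>Only the endpoints need to lie in \<open>GLp\<close> eventually;
    \<open>GLp_rank_one_segment\<close> then covers the whole perturbed segment. The factors 0 and 1
    match the form of \<open>lim\<close>.\<close>
  have "\<forall>\<^sub>F k in sequentially. X k + 0 *\<^sub>R ?D \<in> GLp" "\<forall>\<^sub>F k in sequentially. X k + 1 *\<^sub>R ?D \<in> GLp"
    by (intro topological_tendstoD[OF lim open_GLp] mem; simp)+
  then have ineq: "\<forall>\<^sub>F k in sequentially. W (X k + t *\<^sub>R ?D)
      \<le> (1 - t) * W (X k + 0 *\<^sub>R ?D) + t * W (X k + 1 *\<^sub>R ?D)"
  proof eventually_elim
    case (elim k)
    have "LH_elliptic_at W (X k + s *\<^sub>R ?D)" if "s \<in> {0..1}" for s
    proof -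
      have "X k + s *\<^sub>R ?D \<in> GLp"
        using GLp_rank_one_segment[OF _ _ xi, of "X k" eta s] elim that by simp
      then show ?thesis using LH simple by blast
    qed
    then have "convex_on {0..1} (\<lambda>s. W (X k + s *\<^sub>R ?D))"
      by (rule LH_elliptic_imp_convex_on_line)
    from convex_onD[OF this, of t 0 1] show ?case using t by simp
  qed
  \<comment> \<open>Pass to the limit in \<open>ineq\<close>, using continuity of \<open>W\<close>
    at the parameters \<open>t\<close>, 0 and 1.\<close>
  have "W (F1 + t *\<^sub>R ?D) \<le> (1 - t) * W (F1 + 0 *\<^sub>R ?D) + t * W (F1 + 1 *\<^sub>R ?D)"
    by (rule tendsto_le[OF _ _ _ ineq]) (use t in \<open>auto intro!: tendsto_intros W_lim
        W_lim[of 0, simplified] W_lim[of 1, simplified]\<close>)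
  moreover have "(1 - t) *\<^sub>R F1 + t *\<^sub>R F2 = F1 + t *\<^sub>R ?D"
    by (simp add: F2_eq algebra_simps)
  ultimately show "W ((1 - t) *\<^sub>R F1 + t *\<^sub>R F2) \<le> (1 - t) * W F1 + t * W F2"
    by (simp add: F2_eq)
qed

end
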